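(* Let $r \ge 2$, $n\ge 1$, $d \ge 1$ be integers and let $F = \{f_1,\dots,f_r\}$ be a set of polynomials in $\mathbb{C}[x_1,\dots,x_n]$ (not necessarily homogeneous), no two of which are proportional, with $\deg(f_j) \le d$ for all $j$. Then $|T(F)| \le \binom{r-1}{2}$. Moreover, if $d \le r-3$, then $|T(F)| < \binom{r-1}{2}$.
   Context: For a finite family of polynomials $F = \{f_1,\dots,f_r\}$ over $\mathbb{C}$, the ticket of $F$ is $T(F) = \{m \in \mathbb{N} : f_1^m,\dots,f_r^m \text{ are linearly dependent over } \mathbb{C}\}$, where $\mathbb{N}$ denotes the positive integers. Two polynomials are proportional if one of them is a (constant) complex scalar multiple of the other; in particular, a family of at least two pairwise non-proportional polynomials contains no zero polynomial. *)

theory Defs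
  imports Complex_Main "HOL-Library.Poly_Mapping"
begin

text \<open>Polynomials over the complex numbers in countably many variables: finitely supported
  maps from exponent vectors to coefficients, with the convolution product of
  \<^theory>\<open>HOL-Library.Poly_Mapping\<close>.\<close>

type_synonym cmpoly = "(nat \<Rightarrow>\<^sub>0 nat) \<Rightarrow>\<^sub>0 complex"

text \<open>The polynomial ring in the variables with indices in \<open>V\<close>.\<close>

definition polys_in :: "nat set \<Rightarrow> cmpoly set" where
  "polys_in V = {p. \<forall>\<alpha>\<in>Poly_Mapping.keys p. Poly_Mapping.keys \<alpha> \<subseteq> V}"

text \<open>The constant \<open>Poly_Mapping.degree\<close> is something else (one more than the largest
  key), so the total degree is defined here; it is \<open>0\<close> for the zero polynomial.\<close>

definition total_degree :: "cmpoly \<Rightarrow> nat" where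
  "total_degree p =
     Max (insert 0 ((\<lambda>\<alpha>. \<Sum>i\<in>Poly_Mapping.keys \<alpha>. Poly_Mapping.lookup \<alpha> i) ` Poly_Mapping.keys p))"

definition scale :: "complex \<Rightarrow> cmpoly \<Rightarrow> cmpoly" where
  "scale c p = Poly_Mapping.single 0 c * p"

definition proportional :: "cmpoly \<Rightarrow> cmpoly \<Rightarrow> bool" where
  "proportional p q \<longleftrightarrow> (\<exists>c. p = scale c q) \<or> (\<exists>c. q = scale c p)"

text \<open>Dependence of an indexed family (meant for finite \<open>I\<close>), counting repeated members; the
  library's \<open>module.dependent\<close> concerns the underlying set only.\<close>

definition family_dependent :: "'i set \<Rightarrow> ('i \<Rightarrow> cmpoly) \<Rightarrow> bool" where
  "family_dependent I g \<longleftrightarrow>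
     (\<exists>c. (\<exists>i\<in>I. c i \<noteq> 0) \<and> (\<Sum>i\<in>I. scale (c i) (g i)) = 0)"

definition ticket :: "'i set \<Rightarrow> ('i \<Rightarrow> cmpoly) \<Rightarrow> nat set" where
  "ticket I f = {m. m \<ge> 1 \<and> family_dependent I (\<lambda>i. f i ^ m)}"

end

theory Submission
  imports Defs "Jordan_Normal_Form.Determinant"
begin

text \<open>
  Restrict the family to a line, expand \<open>m\<close>-th powers at a point of the line, and view the
  exponent \<open>m\<close> as an unknown: linear dependence becomes the vanishing of a determinant that is a
  polynomial in \<open>m\<close>.

  Restriction to a line preserves linear relations and does not raise degrees, so it can only
  enlarge the ticket. Two non-proportional polynomials \<open>f, g\<close> have points \<open>p, q\<close> with
  \<open>f(p) g(q) \<noteq> f(q) g(p)\<close>; this condition is open and dense in \<open>(p, q)\<close>, so one pair of points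
  works for the whole family (\<open>line_separates\<close>), and the restrictions
  \<open>g\<^sub>1, \<dots>, g\<^sub>r \<in> \<complex>[t]\<close> to the line through \<open>p\<close> and \<open>q\<close> are still pairwise
  non-proportional. Their pairwise Wronskians are then nonzero, so at some point of the line no
  \<open>g\<^sub>j\<close> vanishes and the logarithmic derivatives are distinct
  (\<open>nonroot_with_distinct_slopes\<close>). Move this point to the origin and normalise to
  \<open>g\<^sub>j = 1 + u\<^sub>j\<close>, where \<open>u\<^sub>j\<close> has no constant term and its linear coefficients
  \<open>s\<^sub>j\<close> are distinct.

  By the binomial theorem the coefficient of \<open>t\<^sup>k\<close> in \<open>(1 + u\<^sub>j)\<^sup>m\<close> is a polynomial in
  \<open>m\<close> of degree at most \<open>k\<close> whose coefficient at \<open>m\<^sup>k\<close> is \<open>s\<^sub>j\<^sup>k / k!\<close>. For \<open>j\<close> and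
  \<open>k < r\<close> these polynomials form an \<open>r \<times> r\<close> matrix, singular at every \<open>m\<close> in the ticket. Its
  determinant has degree at most \<open>0 + 1 + \<dots> + (r - 1)\<close>, and the coefficient there is, up to the
  factorials, the Vandermonde determinant of the \<open>s\<^sub>j\<close>, hence nonzero. Each column \<open>k \<ge> 1\<close> is
  divisible by \<open>m\<close>, since the zeroth power is \<open>1\<close>. After cancelling these \<open>r - 1\<close> factors, degree
  \<open>1 + \<dots> + (r - 2)\<close> is left, which is the binomial coefficient \<open>r - 1\<close> over \<open>2\<close>.

  If \<open>d \<le> r - 3\<close>, then at \<open>m = 1\<close> all columns \<open>k > d\<close> vanish, and there are at least two of them.
  So \<open>1\<close> is a root of multiplicity at least two, and the number of distinct roots drops by at
  least one. \<open>card_dependent_powers_one_plus\<close> treats both cases, with the number of linear factors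
  cancelled from each column as a parameter.
\<close>

section \<open>Evaluation of polynomials in several variables\<close>

definition monom_at :: "(nat \<Rightarrow> 'a::comm_semiring_1) \<Rightarrow> (nat \<Rightarrow>\<^sub>0 nat) \<Rightarrow> 'a" where
  "monom_at x \<alpha> = (\<Prod>i\<in>Poly_Mapping.keys \<alpha>. x i ^ Poly_Mapping.lookup \<alpha> i)"

definition mpoly_eval :: "(nat \<Rightarrow> complex) \<Rightarrow> cmpoly \<Rightarrow> complex" where
  "mpoly_eval x f = (\<Sum>\<alpha>\<in>Poly_Mapping.keys f. Poly_Mapping.lookup f \<alpha> * monom_at x \<alpha>)"

text \<open>The restriction to the line through \<open>p\<close> and \<open>q\<close>, parametrised so that \<open>p\<close> and \<open>q\<close> sit at
  \<open>0\<close> and \<open>1\<close>.\<close>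

definition line_poly :: "(nat \<Rightarrow> complex) \<Rightarrow> (nat \<Rightarrow> complex) \<Rightarrow> cmpoly \<Rightarrow> complex poly" where
  "line_poly p q f = (\<Sum>\<alpha>\<in>Poly_Mapping.keys f.
     smult (Poly_Mapping.lookup f \<alpha>) (monom_at (\<lambda>i. [:p i, q i - p i:]) \<alpha>))"

lemma monom_at_superset:
  assumes "finite A" "Poly_Mapping.keys \<alpha> \<subseteq> A"
  shows "monom_at x \<alpha> = (\<Prod>i\<in>A. x i ^ Poly_Mapping.lookup \<alpha> i)"
  unfolding monom_at_def using assms
  by (intro prod.mono_neutral_left) (auto simp: not_in_keys_iff_lookup_eq_zero)

lemma monom_at_0 [simp]: "monom_at x 0 = 1"
  by (simp add: monom_at_def)

lemma monom_at_add: "monom_at x (\<alpha> + \<beta>) = monom_at x \<alpha> * monom_at x \<beta>"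
proof -
  let ?A = "Poly_Mapping.keys \<alpha> \<union> Poly_Mapping.keys \<beta>"
  have "monom_at x (\<alpha> + \<beta>) = (\<Prod>i\<in>?A. x i ^ Poly_Mapping.lookup (\<alpha> + \<beta>) i)"
    by (intro monom_at_superset) (auto simp: keys_add)
  also have "\<dots> = monom_at x \<alpha> * monom_at x \<beta>"
    by (subst (1 2) monom_at_superset[where A = ?A])
      (auto simp: lookup_add power_add prod.distrib)
  finally show ?thesis .
qed

lemma monom_at_pointwise_mult:
  "monom_at (\<lambda>i. x i * y i) \<alpha> = monom_at x \<alpha> * monom_at y \<alpha>"
  by (simp add: monom_at_def power_mult_distrib prod.distrib)

lemma monom_at_separates:
  assumes "\<alpha> \<noteq> \<beta>"
  shows "\<exists>x :: nat \<Rightarrow> complex. monom_at x \<alpha> \<noteq> monom_at x \<beta>"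
proof -
  obtain i where i: "Poly_Mapping.lookup \<alpha> i \<noteq> Poly_Mapping.lookup \<beta> i"
    using assms by (auto simp: poly_mapping_eq_iff fun_eq_iff)
  \<comment> \<open>At this point a monomial takes the value 2 to the power of its \<open>i\<close>-th exponent.\<close>
  define x :: "nat \<Rightarrow> complex" where "x = (\<lambda>_. 1)(i := 2)"
  have "monom_at x \<gamma> = of_nat (2 ^ Poly_Mapping.lookup \<gamma> i)" for \<gamma>
  proof -
    have "monom_at x \<gamma> = (\<Prod>k\<in>insert i (Poly_Mapping.keys \<gamma>). x k ^ Poly_Mapping.lookup \<gamma> k)"
      by (intro monom_at_superset) auto
    also have "\<dots> = (\<Prod>k\<in>{i}. x k ^ Poly_Mapping.lookup \<gamma> k)"
      by (intro prod.mono_neutral_right) (auto simp: x_def)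
    finally show ?thesis by (simp add: x_def)
  qed
  with i have "monom_at x \<alpha> \<noteq> monom_at x \<beta>"
    by (simp only: of_nat_eq_iff power_inject_exp) simp
  then show ?thesis by blast
qed

text \<open>Dedekind's independence of characters: by \<open>monom_at_pointwise_mult\<close> and
  \<open>monom_at_separates\<close> the monomials are distinct multiplicative functions. Replacing \<open>x\<close> by
  \<open>y x\<close> in a relation and subtracting \<open>monom_at y \<beta>\<close> times the original one eliminates \<open>\<beta>\<close>.\<close>

lemma monom_at_independent:
  fixes c :: "(nat \<Rightarrow>\<^sub>0 nat) \<Rightarrow> complex"
  assumes "finite S" and "\<And>x. (\<Sum>\<alpha>\<in>S. c \<alpha> * monom_at x \<alpha>) = 0"
  shows "\<forall>\<alpha>\<in>S. c \<alpha> = 0"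
  using assms
proof (induction S arbitrary: c rule: finite_induct)
  case (insert \<beta> S)
  have "c \<alpha> = 0" if \<alpha>: "\<alpha> \<in> S" for \<alpha>
  proof -
    obtain y :: "nat \<Rightarrow> complex" where y: "monom_at y \<alpha> \<noteq> monom_at y \<beta>"
      using monom_at_separates[of \<alpha> \<beta>] \<alpha> insert.hyps by blast
    have "(\<Sum>\<gamma>\<in>S. (c \<gamma> * (monom_at y \<gamma> - monom_at y \<beta>)) * monom_at x \<gamma>) = 0" for x
    proof -
      have 1: "(\<Sum>\<gamma>\<in>S. c \<gamma> * monom_at x \<gamma>) = - c \<beta> * monom_at x \<beta>"
        using insert.prems[of x] insert.hyps by (simp add: add_eq_0_iff)
      have 2: "(\<Sum>\<gamma>\<in>S. c \<gamma> * (monom_at y \<gamma> * monom_at x \<gamma>)) = - c \<beta> * (monom_at y \<beta> * monom_at x \<beta>)"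
        using insert.prems[of "\<lambda>i. y i * x i"] insert.hyps
        by (simp add: add_eq_0_iff monom_at_pointwise_mult)
      have "(\<Sum>\<gamma>\<in>S. (c \<gamma> * (monom_at y \<gamma> - monom_at y \<beta>)) * monom_at x \<gamma>)
          = (\<Sum>\<gamma>\<in>S. c \<gamma> * (monom_at y \<gamma> * monom_at x \<gamma>)) - monom_at y \<beta> * (\<Sum>\<gamma>\<in>S. c \<gamma> * monom_at x \<gamma>)"
        by (simp add: algebra_simps sum_subtractf sum_distrib_left)
      also have "\<dots> = 0" unfolding 1 2 by simp
      finally show ?thesis .
    qed
    from insert.IH[OF this] have "c \<alpha> * (monom_at y \<alpha> - monom_at y \<beta>) = 0"
      using \<alpha> by blast
    with y show ?thesis by simp
  qed
  moreover from this have "c \<beta> = 0"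
    using insert.prems[of "\<lambda>_. 1"] insert.hyps by (simp add: monom_at_def)
  ultimately show ?case by blast
qed simp

lemma mpoly_eval_superset:
  assumes "finite A" "Poly_Mapping.keys f \<subseteq> A"
  shows "mpoly_eval x f = (\<Sum>\<alpha>\<in>A. Poly_Mapping.lookup f \<alpha> * monom_at x \<alpha>)"
  unfolding mpoly_eval_def using assms
  by (intro sum.mono_neutral_left) (auto simp: not_in_keys_iff_lookup_eq_zero)

lemma mpoly_eval_0 [simp]: "mpoly_eval x 0 = 0"
  by (simp add: mpoly_eval_def)

lemma mpoly_eval_single [simp]: "mpoly_eval x (Poly_Mapping.single \<alpha> c) = c * monom_at x \<alpha>"
  by (simp add: mpoly_eval_def)

lemma mpoly_eval_1 [simp]: "mpoly_eval x 1 = 1"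
  using mpoly_eval_single[of x 0 1] by simp

lemma mpoly_eval_add: "mpoly_eval x (f + g) = mpoly_eval x f + mpoly_eval x g"
proof -
  let ?A = "Poly_Mapping.keys f \<union> Poly_Mapping.keys g"
  have "mpoly_eval x (f + g) = (\<Sum>\<alpha>\<in>?A. Poly_Mapping.lookup (f + g) \<alpha> * monom_at x \<alpha>)"
    by (intro mpoly_eval_superset) (auto simp: keys_add)
  also have "\<dots> = mpoly_eval x f + mpoly_eval x g"
    by (subst (1 2) mpoly_eval_superset[where A = ?A])
      (auto simp: lookup_add algebra_simps sum.distrib)
  finally show ?thesis .
qed

lemma mpoly_eval_sum: "mpoly_eval x (sum f S) = (\<Sum>i\<in>S. mpoly_eval x (f i))"
  by (induction S rule: infinite_finite_induct) (auto simp: mpoly_eval_add)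

lemma sum_of_terms:
  "(f :: cmpoly) = (\<Sum>\<alpha>\<in>Poly_Mapping.keys f. Poly_Mapping.single \<alpha> (Poly_Mapping.lookup f \<alpha>))"
  by (intro poly_mapping_eqI)
    (auto simp: lookup_sum lookup_single when_def not_in_keys_iff_lookup_eq_zero)

lemma mpoly_eval_mult: "mpoly_eval x (f * g) = mpoly_eval x f * mpoly_eval x g"
proof -
  have "mpoly_eval x (f * g) = (\<Sum>\<alpha>\<in>Poly_Mapping.keys f. \<Sum>\<beta>\<in>Poly_Mapping.keys g.
      Poly_Mapping.lookup f \<alpha> * Poly_Mapping.lookup g \<beta> * monom_at x (\<alpha> + \<beta>))"
    by (subst (1) sum_of_terms[of f], subst (1) sum_of_terms[of g])
      (simp add: sum_product mpoly_eval_sum mult_single)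
  also have "\<dots> = mpoly_eval x f * mpoly_eval x g"
    by (simp add: mpoly_eval_def sum_product monom_at_add algebra_simps)
  finally show ?thesis .
qed

lemma mpoly_eval_power: "mpoly_eval x (f ^ m) = mpoly_eval x f ^ m"
  by (induction m) (auto simp: mpoly_eval_mult)

lemma mpoly_eval_scale: "mpoly_eval x (scale c f) = c * mpoly_eval x f"
  by (simp add: scale_def mpoly_eval_mult)

lemma mpoly_eqI:
  assumes "\<And>x. mpoly_eval x f = mpoly_eval x g"
  shows "f = g"
proof (rule poly_mapping_eqI)
  fix \<alpha>
  let ?A = "insert \<alpha> (Poly_Mapping.keys f \<union> Poly_Mapping.keys g)"
  have "(\<Sum>\<beta>\<in>?A. (Poly_Mapping.lookup f \<beta> - Poly_Mapping.lookup g \<beta>) * monom_at x \<beta>) = 0" for x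
  proof -
    have "(\<Sum>\<beta>\<in>?A. Poly_Mapping.lookup f \<beta> * monom_at x \<beta>) = (\<Sum>\<beta>\<in>?A. Poly_Mapping.lookup g \<beta> * monom_at x \<beta>)"
      using assms[of x] by (subst (asm) (1 2) mpoly_eval_superset[where A = ?A]) auto
    then show ?thesis
      by (simp only: left_diff_distrib sum_subtractf) simp
  qed
  from monom_at_independent[OF _ this] show "Poly_Mapping.lookup f \<alpha> = Poly_Mapping.lookup g \<alpha>"
    by simp
qed

lemma poly_line_poly:
  "poly (line_poly p q f) t = mpoly_eval (\<lambda>i. p i + t * (q i - p i)) f"
  by (simp add: line_poly_def mpoly_eval_def poly_sum monom_at_def poly_prod)

lemma degree_line_poly: "degree (line_poly p q f) \<le> total_degree f"
  unfolding line_poly_def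
proof (rule degree_sum_le)
  fix \<alpha> assume \<alpha>: "\<alpha> \<in> Poly_Mapping.keys f"
  let ?L = "\<lambda>i. [:p i, q i - p i:]"
  have "degree (smult (Poly_Mapping.lookup f \<alpha>) (monom_at ?L \<alpha>)) \<le> degree (monom_at ?L \<alpha>)"
    by (rule degree_smult_le)
  also have "\<dots> \<le> (\<Sum>i\<in>Poly_Mapping.keys \<alpha>. degree (?L i ^ Poly_Mapping.lookup \<alpha> i))"
    unfolding monom_at_def using degree_prod_sum_le[of "Poly_Mapping.keys \<alpha>"] by (simp add: o_def)
  also have "\<dots> \<le> (\<Sum>i\<in>Poly_Mapping.keys \<alpha>. Poly_Mapping.lookup \<alpha> i)"
  proof (rule sum_mono)
    fix i
    have "degree (?L i ^ Poly_Mapping.lookup \<alpha> i) \<le> degree (?L i) * Poly_Mapping.lookup \<alpha> i"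
      by (rule degree_power_le)
    also have "\<dots> \<le> 1 * Poly_Mapping.lookup \<alpha> i" by (intro mult_right_mono) auto
    finally show "degree (?L i ^ Poly_Mapping.lookup \<alpha> i) \<le> Poly_Mapping.lookup \<alpha> i" by simp
  qed
  also have "\<dots> \<le> total_degree f"
    unfolding total_degree_def using \<alpha> by (intro Max_ge) auto
  finally show "degree (smult (Poly_Mapping.lookup f \<alpha>) (monom_at ?L \<alpha>)) \<le> total_degree f" .
qed simp

section \<open>Separating a family on a line\<close>

text \<open>If all these \<open>2 \<times> 2\<close> determinants vanished, fixing \<open>p\<close> with \<open>g(p) \<noteq> 0\<close> would
  exhibit \<open>f\<close> as a multiple of \<open>g\<close>.\<close>

lemma nonproportional_values:
  assumes "\<not> proportional f g"
  shows "\<exists>p q. mpoly_eval p f * mpoly_eval q g - mpoly_eval q f * mpoly_eval p g \<noteq> 0"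
proof (rule ccontr)
  assume "\<not> ?thesis"
  then have eq: "mpoly_eval p f * mpoly_eval q g = mpoly_eval q f * mpoly_eval p g" for p q
    by auto
  have "g \<noteq> 0"
  proof
    assume "g = 0"
    then have "g = scale 0 f" by (simp add: scale_def)
    with assms show False unfolding proportional_def by blast
  qed
  then obtain p where p: "mpoly_eval p g \<noteq> 0"
    using mpoly_eqI[of g 0] by auto
  have "f = scale (mpoly_eval p f / mpoly_eval p g) g"
    using p eq[of p] by (intro mpoly_eqI) (simp add: mpoly_eval_scale field_simps)
  with assms show False by (auto simp: proportional_def)
qed

text \<open>Finitely many functions that are polynomial along lines and not identically zero have a common
  non-root: on the line from a point that works for all but one of them to a point that works for
  the last, every function restricts to a nonzero polynomial, so only finitely many parameters are
  bad. The map \<open>L\<close> abstracts the notion of a line, so that the lemma also covers spaces of pairs of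
  points.\<close>

lemma common_nonzero_point:
  fixes h :: "'i \<Rightarrow> 'v \<Rightarrow> complex"
  assumes "finite I"
    and line: "\<And>u v. \<exists>L :: complex \<Rightarrow> 'v. L 0 = u \<and> L 1 = v \<and>
      (\<forall>i\<in>I. \<exists>P. \<forall>t. h i (L t) = poly P t)"
    and "\<And>i. i \<in> I \<Longrightarrow> \<exists>v. h i v \<noteq> 0"
  shows "\<exists>v. \<forall>i\<in>I. h i v \<noteq> 0"
  using assms
proof (induction I rule: finite_induct)
  case (insert k I)
  obtain u where u: "\<forall>i\<in>I. h i u \<noteq> 0"
    using insert.IH insert.prems by (metis insertCI)
  obtain v where v: "h k v \<noteq> 0" using insert.prems by blast
  obtain L :: "complex \<Rightarrow> 'v" and P where L: "L 0 = u" "L 1 = v"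
    and P: "\<And>i t. i \<in> insert k I \<Longrightarrow> h i (L t) = poly (P i) t"
    using insert.prems(1)[of u v] by metis
  have nz: "P i \<noteq> 0" if "i \<in> insert k I" for i
    using that u v P[OF that, of 0] P[OF that, of 1] L by auto
  have "finite (\<Union>i\<in>insert k I. {t. poly (P i) t = 0})"
    using insert.hyps nz poly_roots_finite by auto
  then obtain t where "t \<notin> (\<Union>i\<in>insert k I. {t. poly (P i) t = 0})"
    using infinite_UNIV_char_0 ex_new_if_finite by blast
  then show ?case using P by (intro exI[of _ "L t"]) auto
qed auto

lemma line_separates:
  assumes "finite J" and "\<And>i j. i \<in> J \<Longrightarrow> j \<in> J \<Longrightarrow> i \<noteq> j \<Longrightarrow> \<not> proportional (f i) (f j)"
  shows "\<exists>p q. \<forall>i\<in>J. \<forall>j\<in>J. i \<noteq> j \<longrightarrow>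
    mpoly_eval p (f i) * mpoly_eval q (f j) - mpoly_eval q (f i) * mpoly_eval p (f j) \<noteq> 0"
proof -
  define I where "I = {(i, j). i \<in> J \<and> j \<in> J \<and> i \<noteq> j}"
  define h where "h = (\<lambda>(i, j) (p, q). mpoly_eval p (f i) * mpoly_eval q (f j)
     - mpoly_eval q (f i) * mpoly_eval p (f j))"
  have "\<exists>v. \<forall>i\<in>I. h i v \<noteq> 0"
  proof (rule common_nonzero_point)
    have "I \<subseteq> J \<times> J" by (auto simp: I_def)
    then show "finite I" using assms(1) finite_subset by blast
  next
    fix u v :: "(nat \<Rightarrow> complex) \<times> (nat \<Rightarrow> complex)"
    obtain a b where u: "u = (a, b)" by force
    obtain a' b' where v: "v = (a', b')" by force
    define L where "L = (\<lambda>t. (\<lambda>i. a i + t * (a' i - a i), \<lambda>i. b i + t * (b' i - b i)))"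
    have "\<exists>P. \<forall>t. h k (L t) = poly P t" for k
    proof -
      obtain i j where k: "k = (i, j)" by force
      show ?thesis
        by (rule exI[of _ "line_poly a a' (f i) * line_poly b b' (f j)
              - line_poly b b' (f i) * line_poly a a' (f j)"])
          (simp add: h_def k L_def poly_line_poly)
    qed
    moreover have "L 0 = u" "L 1 = v" by (simp_all add: L_def u v)
    ultimately show "\<exists>L. L 0 = u \<and> L 1 = v \<and> (\<forall>i\<in>I. \<exists>P. \<forall>t. h i (L t) = poly P t)" by blast
  next
    fix k assume "k \<in> I"
    then show "\<exists>v. h k v \<noteq> 0"
      using nonproportional_values assms(2) by (fastforce simp: I_def h_def)
  qed
  then show ?thesis by (fastforce simp: I_def h_def)
qed

section \<open>Determinants of matrices of polynomials\<close>

lemma coeff_mult_at_degree_bounds: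
  fixes p q :: "'a::comm_semiring_1 poly"
  assumes "degree p \<le> a" "degree q \<le> b"
  shows "coeff (p * q) (a + b) = coeff p a * coeff q b"
proof -
  have "coeff (p * q) (a + b) = (\<Sum>i\<le>a + b. coeff p i * coeff q (a + b - i))"
    by (rule coeff_mult)
  also have "\<dots> = (\<Sum>i\<in>{a}. coeff p i * coeff q (a + b - i))"
  proof (rule sum.mono_neutral_right)
    show "\<forall>i\<in>{..a + b} - {a}. coeff p i * coeff q (a + b - i) = 0"
    proof
      fix i assume "i \<in> {..a + b} - {a}"
      then consider "i > a" | "a + b - i > b" by force
      then show "coeff p i * coeff q (a + b - i) = 0"
        using assms by cases (auto simp: coeff_eq_0)
    qed
  qed auto
  finally show ?thesis by simp
qed

lemma prod_at_degree_bounds: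
  fixes p :: "'i \<Rightarrow> 'a::comm_semiring_1 poly"
  assumes "finite S" "\<And>i. i \<in> S \<Longrightarrow> degree (p i) \<le> N i"
  shows "degree (prod p S) \<le> sum N S"
    and "coeff (prod p S) (sum N S) = (\<Prod>i\<in>S. coeff (p i) (N i))"
proof -
  have "degree (prod p S) \<le> sum N S \<and> coeff (prod p S) (sum N S) = (\<Prod>i\<in>S. coeff (p i) (N i))"
    using assms
  proof (induction S rule: finite_induct)
    case (insert i S)
    then have IH: "degree (prod p S) \<le> sum N S"
      "coeff (prod p S) (sum N S) = (\<Prod>i\<in>S. coeff (p i) (N i))" and i: "degree (p i) \<le> N i"
      by auto
    have "degree (p i * prod p S) \<le> N i + sum N S"
      using degree_mult_le[of "p i" "prod p S"] IH i by linarith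
    then show ?case
      using insert.hyps coeff_mult_at_degree_bounds[OF i IH(1)] IH(2) by simp
  qed auto
  then show "degree (prod p S) \<le> sum N S"
    "coeff (prod p S) (sum N S) = (\<Prod>i\<in>S. coeff (p i) (N i))" by auto
qed

text \<open>Every permutation picks one entry from each column, so every Leibniz term has degree at most the
  sum of the column bounds, and its coefficient there is the matching Leibniz term of the matrix of
  top coefficients.\<close>

lemma det_at_column_degree_bounds:
  fixes Q :: "'a::comm_ring_1 poly mat"
  assumes Q: "Q \<in> carrier_mat r r"
    and deg: "\<And>i k. i < r \<Longrightarrow> k < r \<Longrightarrow> degree (Q $$ (i, k)) \<le> N k"
  shows "degree (det Q) \<le> sum N {0..<r}"
    and "coeff (det Q) (sum N {0..<r}) = det (mat r r (\<lambda>(i, k). coeff (Q $$ (i, k)) (N k)))"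
proof -
  \<comment> \<open>Seeing the sign as a constant polynomial turns multiplication by it into \<open>smult\<close>.\<close>
  have sgn: "signof \<pi> = [:signof \<pi>:]" for \<pi> :: "nat \<Rightarrow> nat"
    by (auto simp: sign_def one_pCons)
  have *: "degree (\<Prod>i = 0..<r. Q $$ (i, \<pi> i)) \<le> sum N {0..<r} \<and>
      coeff (\<Prod>i = 0..<r. Q $$ (i, \<pi> i)) (sum N {0..<r})
        = (\<Prod>i = 0..<r. coeff (Q $$ (i, \<pi> i)) (N (\<pi> i)))" if \<pi>: "\<pi> permutes {0..<r}" for \<pi>
  proof -
    have eq: "sum N {0..<r} = (\<Sum>i = 0..<r. N (\<pi> i))"
      using sum.permute[OF \<pi>, of N] by (simp add: o_def)
    have "\<pi> i < r" if "i < r" for i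
      using permutes_in_image[OF \<pi>, of i] that by simp
    then show ?thesis unfolding eq
      by (intro conjI prod_at_degree_bounds) (auto intro!: deg)
  qed
  have summand: "degree (signof \<pi> * (\<Prod>i = 0..<r. Q $$ (i, \<pi> i))) \<le> sum N {0..<r} \<and>
      coeff (signof \<pi> * (\<Prod>i = 0..<r. Q $$ (i, \<pi> i))) (sum N {0..<r})
        = signof \<pi> * (\<Prod>i = 0..<r. coeff (Q $$ (i, \<pi> i)) (N (\<pi> i)))"
    if \<pi>: "\<pi> permutes {0..<r}" for \<pi>
    using *[OF \<pi>] by (subst (1 2) sgn) (auto intro: order.trans[OF degree_smult_le])
  show "degree (det Q) \<le> sum N {0..<r}"
    unfolding det_def'[OF Q]
    by (intro degree_sum_le) (use summand in \<open>auto simp: finite_permutations\<close>)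
  have "coeff (det Q) (sum N {0..<r})
      = (\<Sum>\<pi> | \<pi> permutes {0..<r}. signof \<pi> * (\<Prod>i = 0..<r. coeff (Q $$ (i, \<pi> i)) (N (\<pi> i))))"
    unfolding det_def'[OF Q] coeff_sum by (intro sum.cong) (use summand in auto)
  also have "\<dots> = det (mat r r (\<lambda>(i, k). coeff (Q $$ (i, k)) (N k)))"
  proof -
    have "\<pi> i < r" if "\<pi> permutes {0..<r}" "i < r" for \<pi> i
      using permutes_in_image[OF that(1), of i] that by simp
    then show ?thesis
      by (subst det_def'[where n = r]) (auto intro!: sum.cong prod.cong)
  qed
  finally show "coeff (det Q) (sum N {0..<r}) = det (mat r r (\<lambda>(i, k). coeff (Q $$ (i, k)) (N k)))" .
qed

lemma det_zero_if_rows_dependent: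
  fixes A :: "'a::idom mat"
  assumes A: "A \<in> carrier_mat r r" and "\<exists>j<r. c j \<noteq> 0"
    and "\<And>k. k < r \<Longrightarrow> (\<Sum>j<r. c j * A $$ (j, k)) = 0"
  shows "det A = 0"
proof -
  have At: "A\<^sup>T \<in> carrier_mat r r" using A by simp
  have "vec r c \<noteq> 0\<^sub>v r" using assms(2) by (metis index_vec index_zero_vec(1))
  moreover have "A\<^sup>T *\<^sub>v vec r c = 0\<^sub>v r"
    using A assms(3)
    by (intro eq_vecI) (auto simp: scalar_prod_def mult.commute atLeast0LessThan)
  ultimately have "det A\<^sup>T = 0"
    unfolding det_0_iff_vec_prod_zero[OF At] by (intro exI[of _ "vec r c"]) auto
  then show ?thesis using det_transpose[OF A] by simp
qed

text \<open>A kernel vector would be, up to the nonzero weights, the coefficient vector of a nonzero polynomial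
  of degree less than \<open>r\<close> with the \<open>r\<close> roots \<open>s j\<close>.\<close>

lemma scaled_vandermonde_nonsingular:
  fixes s :: "nat \<Rightarrow> 'a::field"
  assumes inj: "inj_on s {..<r}" and w: "\<And>k. k < r \<Longrightarrow> w k \<noteq> 0"
  shows "det (mat r r (\<lambda>(j, k). w k * s j ^ k)) \<noteq> 0"
proof
  assume "det (mat r r (\<lambda>(j, k). w k * s j ^ k)) = 0"
  then obtain v where v: "v \<in> carrier_vec r" "v \<noteq> 0\<^sub>v r"
    and Av: "mat r r (\<lambda>(j, k). w k * s j ^ k) *\<^sub>v v = 0\<^sub>v r"
    by (subst (asm) det_0_iff_vec_prod_zero[where n = r]) auto
  define P where "P = (\<Sum>k<r. monom (w k * v $ k) k)"
  have coeffP: "coeff P k = (if k < r then w k * v $ k else 0)" for k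
    by (simp add: P_def coeff_sum)
  have root: "poly P (s j) = 0" if j: "j < r" for j
  proof -
    have "poly P (s j) = (mat r r (\<lambda>(j, k). w k * s j ^ k) *\<^sub>v v) $ j"
      using j v by (simp add: P_def poly_sum poly_monom scalar_prod_def mult_ac atLeast0LessThan)
    then show ?thesis using j Av by simp
  qed
  have "P = 0"
  proof (rule ccontr)
    assume "P \<noteq> 0"
    then have "coeff P (degree P) \<noteq> 0" by simp
    then have "degree P < r" using coeffP by metis
    moreover have "card (s ` {..<r}) \<le> card {x. poly P x = 0}"
      by (intro card_mono poly_roots_finite \<open>P \<noteq> 0\<close>) (use root in auto)
    moreover have "card {x. poly P x = 0} \<le> degree P"
      by (rule card_poly_roots_bound[OF \<open>P \<noteq> 0\<close>])
    ultimately show False using card_image[OF inj] by simp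
  qed
  then have "v $ k = 0" if "k < r" for k
    using coeffP[of k] w[OF that] that by simp
  then have "v = 0\<^sub>v r" using v by (intro eq_vecI) auto
  with v show False by simp
qed

text \<open>The parameters are roots of the determinant of the matrix \<open>q\<close>, which is nonzero because its
  coefficient at the degree bound is.\<close>

lemma card_parameters_with_dependent_rows:
  fixes q :: "nat \<Rightarrow> nat \<Rightarrow> 'a::{field_char_0} poly"
  assumes deg: "\<And>j k. j < r \<Longrightarrow> k < r \<Longrightarrow> degree (q j k) \<le> N k"
    and top: "det (mat r r (\<lambda>(j, k). coeff (q j k) (N k))) \<noteq> 0"
  defines "Z \<equiv> {m :: nat. \<exists>c :: nat \<Rightarrow> 'a. (\<exists>j<r. c j \<noteq> 0) \<and> (\<forall>k<r. (\<Sum>j<r. c j * poly (q j k) (of_nat m)) = 0)}"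
  shows "finite Z \<and> card Z \<le> sum N {..<r}"
proof -
  define Q where "Q = mat r r (\<lambda>(j, k). q j k)"
  have Q: "Q \<in> carrier_mat r r" by (simp add: Q_def)
  have "coeff (det Q) (sum N {0..<r}) = det (mat r r (\<lambda>(i, k). coeff (Q $$ (i, k)) (N k)))"
    by (rule det_at_column_degree_bounds(2)[OF Q]) (simp add: Q_def deg)
  also have "mat r r (\<lambda>(i, k). coeff (Q $$ (i, k)) (N k)) = mat r r (\<lambda>(j, k). coeff (q j k) (N k))"
    by (intro eq_matI) (auto simp: Q_def)
  finally have nz: "det Q \<noteq> 0" using top by auto
  have le: "degree (det Q) \<le> sum N {0..<r}"
    by (rule det_at_column_degree_bounds(1)[OF Q]) (simp add: Q_def deg)
  have root: "poly (det Q) (of_nat m) = 0" if m: "m \<in> Z" for m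
  proof -
    interpret ev: comm_ring_hom "\<lambda>p. poly p (of_nat m :: 'a)"
      by unfold_locales auto
    obtain c :: "nat \<Rightarrow> 'a" where c: "\<exists>j<r. c j \<noteq> 0" "\<forall>k<r. (\<Sum>j<r. c j * poly (q j k) (of_nat m)) = 0"
      using m unfolding Z_def by blast
    have "det (map_mat (\<lambda>p. poly p (of_nat m)) Q) = 0"
      by (rule det_zero_if_rows_dependent[where c = c and r = r]) (use c in \<open>auto simp: Q_def\<close>)
    then show ?thesis by simp
  qed
  have "(of_nat ` Z :: 'a set) \<subseteq> {x. poly (det Q) x = 0}" using root by auto
  moreover have "finite {x. poly (det Q) x = 0}" by (rule poly_roots_finite[OF nz])
  moreover have inj: "inj_on (of_nat :: nat \<Rightarrow> 'a) Z" by (simp add: inj_on_def)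
  ultimately have "finite Z" "card Z \<le> card {x. poly (det Q) x = 0}"
    using finite_subset finite_imageD card_mono card_image by metis+
  moreover have "card {x. poly (det Q) x = 0} \<le> degree (det Q)"
    by (rule card_poly_roots_bound[OF nz])
  ultimately show ?thesis using le by (simp add: atLeast0LessThan)
qed

section \<open>Coefficients of powers as polynomials in the exponent\<close>

lemma coeff_power_without_constant_term:
  fixes u :: "'a::comm_semiring_1 poly"
  assumes "coeff u 0 = 0"
  shows "k < i \<Longrightarrow> coeff (u ^ i) k = 0" and "coeff (u ^ k) k = coeff u 1 ^ k"
proof -
  obtain w where w: "u = pCons 0 w"
    using assms by (cases u) auto
  have "u = monom 1 1 * w"
    by (simp add: w monom_altdef)
  then have "u ^ i = monom 1 i * w ^ i" for i
    by (simp add: power_mult_distrib monom_power)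
  then have *: "coeff (u ^ i) k = (if k < i then 0 else coeff (w ^ i) (k - i))" for i k
    by (simp add: coeff_monom_mult)
  show "k < i \<Longrightarrow> coeff (u ^ i) k = 0" by (simp add: *)
  have "coeff u 1 = coeff w 0" by (simp add: w)
  then show "coeff (u ^ k) k = coeff u 1 ^ k" by (simp add: * coeff_0_power)
qed

text \<open>The polynomial \<open>(m - a) (m - (a + 1)) \<dots> (m - (b - 1))\<close> in the unknown \<open>m\<close>. For \<open>a = 0\<close> this
  is \<open>b!\<close> times a binomial coefficient; \<open>a > 0\<close> leaves out the roots \<open>0, \<dots>, a - 1\<close>.\<close>

definition falling_poly :: "nat \<Rightarrow> nat \<Rightarrow> 'a::comm_ring_1 poly" where
  "falling_poly a b = (\<Prod>l\<in>{a..<b}. [:- of_nat l, 1:])"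

lemma degree_falling_poly: "degree (falling_poly a b :: 'a::idom poly) = b - a"
  unfolding falling_poly_def by (subst degree_prod_eq_sum_degree) auto

lemma coeff_falling_poly_top: "coeff (falling_poly a b :: 'a::idom poly) (b - a) = 1"
proof -
  have "lead_coeff (falling_poly a b :: 'a poly) = 1"
    unfolding falling_poly_def by (simp add: lead_coeff_prod)
  then show ?thesis by (simp add: degree_falling_poly)
qed

lemma of_nat_binomial_split:
  assumes "a \<le> i"
  shows "(of_nat (m choose i) :: 'a::field_char_0)
    = poly (falling_poly 0 a) (of_nat m) * (poly (falling_poly a i) (of_nat m) / fact i)"
proof -
  have "(of_nat (m choose i) :: 'a) = (\<Prod>l\<in>{0..<i}. of_nat m - of_nat l) / fact i"
    by (simp add: binomial_gbinomial gbinomial_prod_rev)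
  also have "(\<Prod>l\<in>{0..<i}. of_nat m - of_nat l :: 'a)
      = (\<Prod>l\<in>{0..<a}. of_nat m - of_nat l) * (\<Prod>l\<in>{a..<i}. of_nat m - of_nat l)"
    using assms by (simp add: prod.atLeastLessThan_concat)
  finally show ?thesis
    by (simp add: falling_poly_def poly_prod)
qed

text \<open>By \<open>coeff_power_one_plus\<close> below, this is the coefficient of \<open>t\<^sup>k\<close> in \<open>(1 + u)\<^sup>m\<close> as a
  polynomial in \<open>m\<close>, with the factor \<open>m (m - 1) \<dots> (m - a + 1)\<close> cancelled.\<close>

definition power_coeff_poly :: "'a::field_char_0 poly \<Rightarrow> nat \<Rightarrow> nat \<Rightarrow> 'a poly" where
  "power_coeff_poly u a k = (\<Sum>i\<in>{a..k}. smult (coeff (u ^ i) k / fact i) (falling_poly a i))"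

text \<open>In the binomial expansion only \<open>u\<^sup>i\<close> with \<open>a \<le> i \<le> k\<close> contributes to \<open>t\<^sup>k\<close>: smaller powers
  by assumption, larger ones because \<open>u\<close> has no constant term. All remaining binomial coefficients
  share the factor \<open>m (m - 1) \<dots> (m - a + 1)\<close>.\<close>

lemma coeff_power_one_plus:
  fixes u :: "'a::field_char_0 poly"
  assumes u0: "coeff u 0 = 0" and low: "\<And>i. i < a \<Longrightarrow> coeff (u ^ i) k = 0"
  shows "coeff ((1 + u) ^ m) k
    = poly (falling_poly 0 a) (of_nat m) * poly (power_coeff_poly u a k) (of_nat m)"
proof -
  have "coeff ((1 + u) ^ m) k = (\<Sum>i\<le>m. of_nat (m choose i) * coeff (u ^ i) k)"
    by (subst add.commute) (simp add: binomial_ring[of u 1 m] coeff_sum of_nat_poly)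
  also have "\<dots> = (\<Sum>i\<le>max m k. of_nat (m choose i) * coeff (u ^ i) k)"
    by (intro sum.mono_neutral_left) auto
  also have "\<dots> = (\<Sum>i\<in>{a..k}. of_nat (m choose i) * coeff (u ^ i) k)"
  proof (intro sum.mono_neutral_right ballI)
    fix i assume "i \<in> {..max m k} - {a..k}"
    then have "i < a \<or> k < i" by auto
    then show "of_nat (m choose i) * coeff (u ^ i) k = 0"
      using low coeff_power_without_constant_term(1)[OF u0] by auto
  qed auto
  also have "\<dots> = (\<Sum>i\<in>{a..k}. poly (falling_poly 0 a) (of_nat m) *
      (coeff (u ^ i) k / fact i * poly (falling_poly a i) (of_nat m)))"
    by (intro sum.cong refl, subst of_nat_binomial_split[where a = a]) auto
  finally show ?thesis
    by (simp add: power_coeff_poly_def poly_sum sum_distrib_left)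
qed

text \<open>Only the summand \<open>i = k\<close> reaches degree \<open>k - a\<close>.\<close>

lemma power_coeff_poly_top:
  assumes "coeff u 0 = 0" and "a \<le> k"
  shows "degree (power_coeff_poly u a k) \<le> k - a"
    and "coeff (power_coeff_poly u a k) (k - a) = coeff u 1 ^ k / fact k"
proof -
  show "degree (power_coeff_poly u a k) \<le> k - a"
    unfolding power_coeff_poly_def
    by (intro degree_sum_le) (auto simp: degree_falling_poly intro!: order.trans[OF degree_smult_le])
  have "coeff (power_coeff_poly u a k) (k - a)
      = (\<Sum>i\<in>{a..k}. coeff (u ^ i) k / fact i * coeff (falling_poly a i) (k - a))"
    by (simp add: power_coeff_poly_def coeff_sum)
  also have "\<dots> = (\<Sum>i\<in>{k}. coeff (u ^ i) k / fact i * coeff (falling_poly a i) (k - a))"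
    using assms(2)
    by (intro sum.mono_neutral_right) (auto intro!: coeff_eq_0 simp: degree_falling_poly)
  also have "\<dots> = coeff u 1 ^ k / fact k"
    using coeff_power_without_constant_term(2)[OF assms(1)] by (simp add: coeff_falling_poly_top)
  finally show "coeff (power_coeff_poly u a k) (k - a) = coeff u 1 ^ k / fact k" .
qed

text \<open>The parameter \<open>s k\<close> is the number of linear factors \<open>m, m - 1, \<dots>\<close> cancelled from column
  \<open>k\<close>. Cancelling loses the exponents at which a cancelled factor vanishes, which is why only
  exponents \<open>m\<close> with \<open>s k \<le> m\<close> are counted.\<close>

lemma card_dependent_powers_one_plus:
  fixes u :: "nat \<Rightarrow> 'a::field_char_0 poly"
  assumes u0: "\<And>j. j < r \<Longrightarrow> coeff (u j) 0 = 0"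
    and slopes: "inj_on (\<lambda>j. coeff (u j) 1) {..<r}"
    and s: "\<And>k. k < r \<Longrightarrow> s k \<le> k"
    and low: "\<And>j k i. j < r \<Longrightarrow> k < r \<Longrightarrow> i < s k \<Longrightarrow> coeff (u j ^ i) k = 0"
  defines "Z \<equiv> {m. (\<forall>k<r. s k \<le> m) \<and>
    (\<exists>c. (\<exists>j<r. c j \<noteq> 0) \<and> (\<Sum>j<r. smult (c j) ((1 + u j) ^ m)) = 0)}"
  shows "finite Z \<and> card Z \<le> (\<Sum>k<r. k - s k)"
proof -
  define q where "q = (\<lambda>j k. power_coeff_poly (u j) (s k) k)"
  define Z' where "Z' = {m :: nat. \<exists>c :: nat \<Rightarrow> 'a. (\<exists>j<r. c j \<noteq> 0) \<and>
    (\<forall>k<r. (\<Sum>j<r. c j * poly (q j k) (of_nat m)) = 0)}"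
  have "finite Z' \<and> card Z' \<le> sum (\<lambda>k. k - s k) {..<r}"
    unfolding Z'_def
  proof (rule card_parameters_with_dependent_rows)
    show "degree (q j k) \<le> k - s k" if "j < r" "k < r" for j k
      unfolding q_def using that u0 s by (intro power_coeff_poly_top(1)) auto
    have "mat r r (\<lambda>(j, k). coeff (q j k) (k - s k))
        = mat r r (\<lambda>(j, k). inverse (fact k) * coeff (u j) 1 ^ k)"
      by (intro eq_matI)
        (auto simp: q_def power_coeff_poly_top(2)[OF u0 s, unfolded One_nat_def] divide_inverse)
    moreover have "det (mat r r (\<lambda>(j, k). inverse (fact k) * coeff (u j) 1 ^ k)) \<noteq> 0"
      by (rule scaled_vandermonde_nonsingular[OF slopes]) simp
    ultimately show "det (mat r r (\<lambda>(j, k). coeff (q j k) (k - s k))) \<noteq> 0" by metis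
  qed
  moreover have "Z \<subseteq> Z'"
  proof
    fix m assume "m \<in> Z"
    then obtain c where m: "\<forall>k<r. s k \<le> m" and c: "\<exists>j<r. c j \<noteq> 0"
      and dep: "(\<Sum>j<r. smult (c j) ((1 + u j) ^ m)) = 0"
      unfolding Z_def by blast
    have "(\<Sum>j<r. c j * poly (q j k) (of_nat m)) = 0" if k: "k < r" for k
    proof -
      let ?e = "poly (falling_poly 0 (s k)) (of_nat m) :: 'a"
      have "?e \<noteq> 0"
        using m k by (auto simp: falling_poly_def poly_prod)
      have "0 = coeff (\<Sum>j<r. smult (c j) ((1 + u j) ^ m)) k" by (simp add: dep)
      also have "\<dots> = (\<Sum>j<r. c j * (?e * poly (q j k) (of_nat m)))"
        unfolding coeff_sum q_def coeff_smult using low k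
        by (intro sum.cong refl) (subst coeff_power_one_plus[OF u0, where a = "s k"], auto)
      also have "\<dots> = ?e * (\<Sum>j<r. c j * poly (q j k) (of_nat m))"
        by (simp add: sum_distrib_left mult_ac)
      finally show ?thesis using \<open>?e \<noteq> 0\<close> by simp
    qed
    with c show "m \<in> Z'" unfolding Z'_def by blast
  qed
  ultimately show ?thesis
    using finite_subset[of Z Z'] card_mono[of Z' Z] by (meson order.trans)
qed

lemma sum_pred_eq_choose_2: "(\<Sum>k<r. k - 1) = (r - 1) choose 2"
proof (induction r)
  case (Suc r)
  then show ?case by (cases r) (auto simp: numeral_2_eq_2)
qed simp

lemma pcompose_power: "(p ^ m) \<circ>\<^sub>p q = (p \<circ>\<^sub>p q) ^ m"
  for p q :: "'a::comm_ring_1 poly"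
  by (induction m) (auto simp: pcompose_mult pcompose_1)

text \<open>Translating \<open>t\<close> to the origin and dividing by the values \<open>a j\<close> there brings the family to the
  form \<open>1 + u j\<close> without affecting dependence of powers. For the weak bound one factor \<open>m\<close> is
  cancelled from each column \<open>k \<ge> 1\<close>; for the strict bound also the factor \<open>m - 1\<close> from each
  column \<open>k > d\<close>.\<close>

lemma card_dependent_exponents:
  fixes g :: "nat \<Rightarrow> complex poly"
  assumes nz: "\<And>j. j < r \<Longrightarrow> poly (g j) t \<noteq> 0"
    and slopes: "inj_on (\<lambda>j. poly (pderiv (g j)) t / poly (g j) t) {..<r}"
    and deg: "\<And>j. j < r \<Longrightarrow> degree (g j) \<le> d" and d: "d \<ge> 1"
  defines "D \<equiv> {m. m \<ge> 1 \<and> (\<exists>c. (\<exists>j<r. c j \<noteq> 0) \<and> (\<Sum>j<r. smult (c j) (g j ^ m)) = 0)}"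
  shows "finite D" and "card D \<le> (r - 1) choose 2" and "d + 3 \<le> r \<Longrightarrow> card D < (r - 1) choose 2"
proof -
  define a where "a = (\<lambda>j. poly (g j) t)"
  define h where "h = (\<lambda>j. g j \<circ>\<^sub>p [:t, 1:])"
  define u where "u = (\<lambda>j. smult (inverse (a j)) (h j) - 1)"
  have h: "h j = smult (a j) (1 + u j)" if "j < r" for j
    using nz[OF that] by (simp add: u_def a_def)
  have h0: "coeff (h j) 0 = a j" for j
    by (simp add: h_def a_def poly_pcompose flip: poly_0_coeff_0)
  have h1: "coeff (h j) 1 = poly (pderiv (g j)) t" for j
  proof -
    have "coeff (h j) 1 = poly (pderiv (h j)) 0"
      by (simp add: poly_0_coeff_0 coeff_pderiv)
    then show ?thesis by (simp add: h_def pderiv_pcompose poly_pcompose pderiv_pCons)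
  qed
  have u0: "coeff (u j) 0 = 0" if "j < r" for j
    using nz[OF that] by (simp add: u_def h0 a_def)
  have u1: "coeff (u j) 1 = poly (pderiv (g j)) t / poly (g j) t" for j
    using h1[of j] by (simp add: u_def a_def divide_inverse mult.commute)
  have uk: "coeff (u j) k = 0" if "j < r" "k > d" for j k
  proof -
    have "degree (h j) < k"
      using deg[OF that(1)] that(2) by (simp add: h_def degree_pcompose)
    then show ?thesis using that d by (simp add: u_def coeff_eq_0)
  qed
  have slopes_u: "inj_on (\<lambda>j. coeff (u j) 1) {..<r}"
    using slopes unfolding u1 .
  have dep_u: "\<exists>c. (\<exists>j<r. c j \<noteq> 0) \<and> (\<Sum>j<r. smult (c j) ((1 + u j) ^ m)) = 0" if m: "m \<in> D" for m
  proof -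
    obtain c where c: "\<exists>j<r. c j \<noteq> 0" and dep: "(\<Sum>j<r. smult (c j) (g j ^ m)) = 0"
      using m unfolding D_def by blast
    have "(\<Sum>j<r. smult (c j * a j ^ m) ((1 + u j) ^ m)) = (\<Sum>j<r. smult (c j) (h j ^ m))"
      by (intro sum.cong refl) (simp add: h smult_power)
    also have "\<dots> = (\<Sum>j<r. smult (c j) (g j ^ m)) \<circ>\<^sub>p [:t, 1:]"
      by (simp add: h_def pcompose_sum pcompose_smult pcompose_power)
    finally have "(\<Sum>j<r. smult (c j * a j ^ m) ((1 + u j) ^ m)) = 0" by (simp add: dep)
    moreover have "\<exists>j<r. c j * a j ^ m \<noteq> 0" using c nz by (auto simp: a_def)
    ultimately show ?thesis by (intro exI[of _ "\<lambda>j. c j * a j ^ m"] conjI)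
  qed
  define Z where "Z = (\<lambda>s. {m. (\<forall>k<r. s k \<le> m) \<and>
    (\<exists>c. (\<exists>j<r. c j \<noteq> 0) \<and> (\<Sum>j<r. smult (c j) ((1 + u j) ^ m)) = 0)})"

  define s1 :: "nat \<Rightarrow> nat" where "s1 = (\<lambda>k. min k 1)"
  have Z1: "finite (Z s1) \<and> card (Z s1) \<le> (\<Sum>k<r. k - s1 k)"
    unfolding Z_def
  proof (rule card_dependent_powers_one_plus[OF u0 slopes_u])
    show "coeff (u j ^ i) k = 0" if "j < r" "k < r" "i < s1 k" for j k i
      using that by (auto simp: s1_def)
  qed (auto simp: s1_def)
  have "D \<subseteq> Z s1"
    unfolding Z_def using dep_u by (auto simp: s1_def D_def)
  then show "finite D" using Z1 finite_subset by blast
  have "(\<Sum>k<r. k - s1 k) = (r - 1) choose 2"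
    unfolding sum_pred_eq_choose_2[symmetric] by (intro sum.cong) (auto simp: s1_def)
  then show "card D \<le> (r - 1) choose 2"
    using Z1 card_mono[of "Z s1" D] \<open>D \<subseteq> Z s1\<close> by linarith

  assume r: "d + 3 \<le> r"
  define s2 :: "nat \<Rightarrow> nat" where "s2 = (\<lambda>k. if k = 0 then 0 else if k \<le> d then 1 else 2)"
  have Z2: "finite (Z s2) \<and> card (Z s2) \<le> (\<Sum>k<r. k - s2 k)"
    unfolding Z_def
  proof (rule card_dependent_powers_one_plus[OF u0 slopes_u])
    show "coeff (u j ^ i) k = 0" if "j < r" "k < r" "i < s2 k" for j k i
    proof -
      have "i = 0 \<and> k > 0 \<or> i = 1 \<and> k > d"
        using that(3) by (auto simp: s2_def split: if_splits)
      then show ?thesis using uk that(1) by auto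
    qed
  qed (use d in \<open>auto simp: s2_def\<close>)
  \<comment> \<open>Cancelling \<open>m - 1\<close> loses the exponent 1, so it is counted separately.\<close>
  have "D \<subseteq> insert 1 (Z s2)"
    unfolding Z_def using dep_u by (auto simp: s2_def D_def)
  then have "card D \<le> card (insert 1 (Z s2))"
    using Z2 by (intro card_mono) auto
  also have "\<dots> \<le> Suc (\<Sum>k<r. k - s2 k)"
    using Z2 card_insert_le_m1 by (metis card_insert_if le_SucI Suc_le_mono)
  \<comment> \<open>The two columns \<open>r - 2\<close> and \<open>r - 1\<close> lie beyond \<open>d\<close> and each save one degree against
    the weak bound, which outweighs the one exponent counted separately.\<close>
  also have "\<dots> < (\<Sum>k<r. k - s2 k) + card {r - 2, r - 1}"
    using r by simp
  also have "card {r - 2, r - 1} = (\<Sum>k<r. if k \<in> {r - 2, r - 1} then 1 else 0)"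
  proof -
    have "{..<r} \<inter> {r - 2, r - 1} = {r - 2, r - 1}" using r by auto
    then show ?thesis by (subst sum.inter_restrict[symmetric]) auto
  qed
  also have "(\<Sum>k<r. k - s2 k) + \<dots> \<le> (\<Sum>k<r. k - 1)"
    unfolding sum.distrib[symmetric]
    by (rule sum_mono) (use r d in \<open>auto simp: s2_def\<close>)
  finally show "card D < (r - 1) choose 2" unfolding sum_pred_eq_choose_2 .
qed

section \<open>Wronskians and logarithmic derivatives\<close>

text \<open>At degree \<open>degree f + degree g\<close>, the coefficient of \<open>t (f' g - f g')\<close> is \<open>degree f - degree g\<close>
  times the product of the two leading coefficients.\<close>

lemma degree_eq_if_wronskian_zero:
  fixes f g :: "'a::field_char_0 poly"
  assumes W: "pderiv f * g = f * pderiv g" and "f \<noteq> 0" "g \<noteq> 0"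
  shows "degree f = degree g"
proof -
  \<comment> \<open>The operator sending \<open>p\<close> to \<open>t p'\<close> multiplies the coefficient of each power of \<open>t\<close> by its
    exponent, which avoids the truncated \<open>degree p - 1\<close> for constant \<open>p\<close>.\<close>
  have euler: "degree (pCons 0 (pderiv p)) \<le> degree p"
    "coeff (pCons 0 (pderiv p)) (degree p) = of_nat (degree p) * lead_coeff p" for p :: "'a poly"
    by (cases "degree p"; auto simp: degree_pderiv coeff_pderiv coeff_pCons degree_pCons_eq_if
        pderiv_eq_0_iff split: nat.split)+
  have "of_nat (degree f) * lead_coeff f * lead_coeff g
      = coeff (pCons 0 (pderiv f) * g) (degree f + degree g)"
    by (simp only: coeff_mult_at_degree_bounds[OF euler(1) order_refl] euler(2))
  also have "pCons 0 (pderiv f) * g = f * pCons 0 (pderiv g)"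
    using W by simp
  also have "coeff \<dots> (degree f + degree g) = lead_coeff f * (of_nat (degree g) * lead_coeff g)"
    by (simp only: coeff_mult_at_degree_bounds[OF order_refl euler(1)] euler(2))
  finally have "(of_nat (degree f) :: 'a) = of_nat (degree g)"
    using assms(2,3) by simp
  then show ?thesis by simp
qed

text \<open>The combination \<open>h\<close> of \<open>f\<close> and \<open>g\<close> that cancels the leading terms again has zero
  Wronskian with \<open>g\<close>, but cannot have the same degree as \<open>g\<close>; so it is zero.\<close>

lemma multiple_if_wronskian_zero:
  fixes f g :: "'a::field_char_0 poly"
  assumes W: "pderiv f * g = f * pderiv g" and "g \<noteq> 0"
  shows "\<exists>c. f = smult c g"
proof (cases "f = 0")
  case False
  define h where "h = smult (lead_coeff g) f - smult (lead_coeff f) g"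
  have "pderiv h * g = h * pderiv g"
    using W by (simp add: h_def pderiv_diff pderiv_smult algebra_simps)
  moreover have "coeff h (degree g) = 0"
    using degree_eq_if_wronskian_zero[OF W False \<open>g \<noteq> 0\<close>] by (simp add: h_def)
  ultimately have "h = 0"
    using degree_eq_if_wronskian_zero[of h g] \<open>g \<noteq> 0\<close> leading_coeff_0_iff by metis
  then have "smult (lead_coeff g) f = smult (lead_coeff f) g" by (simp add: h_def)
  then have "f = smult (lead_coeff f / lead_coeff g) g"
    using \<open>g \<noteq> 0\<close>
    by (metis (no_types, lifting) divide_inverse leading_coeff_0_iff mult.commute right_inverse
        smult_1_left smult_smult)
  then show ?thesis by blast
qed (auto intro: exI[of _ 0])

text \<open>Where \<open>g i\<close> and \<open>g j\<close> do not vanish, their logarithmic derivatives agree only at roots of their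
  Wronskian, so all but finitely many points qualify.\<close>

lemma nonroot_with_distinct_slopes:
  fixes g :: "'i \<Rightarrow> complex poly"
  assumes "finite I" and nz: "\<And>i. i \<in> I \<Longrightarrow> g i \<noteq> 0"
    and indep: "\<And>i j c. i \<in> I \<Longrightarrow> j \<in> I \<Longrightarrow> i \<noteq> j \<Longrightarrow> g i \<noteq> smult c (g j)"
  shows "\<exists>t. (\<forall>i\<in>I. poly (g i) t \<noteq> 0) \<and> inj_on (\<lambda>i. poly (pderiv (g i)) t / poly (g i) t) I"
proof -
  define W where "W = (\<lambda>i j. pderiv (g i) * g j - g i * pderiv (g j))"
  have W: "W i j \<noteq> 0" if "i \<in> I" "j \<in> I" "i \<noteq> j" for i j
    using multiple_if_wronskian_zero[of "g i" "g j"] indep[OF that] nz[OF that(2)]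
    by (auto simp: W_def)
  define B where "B = (\<Union>i\<in>I. {t. poly (g i) t = 0}) \<union> (\<Union>i\<in>I. \<Union>j\<in>I - {i}. {t. poly (W i j) t = 0})"
  have "finite B"
    unfolding B_def
    by (intro finite_UnI finite_UN_I poly_roots_finite finite_Diff assms(1) nz W) auto
  then obtain t where t: "t \<notin> B"
    using ex_new_if_finite[OF infinite_UNIV_char_0] by metis
  then have nonroot: "poly (g i) t \<noteq> 0" if "i \<in> I" for i
    using that by (auto simp: B_def)
  have "inj_on (\<lambda>i. poly (pderiv (g i)) t / poly (g i) t) I"
  proof (rule inj_onI, rule ccontr)
    fix i j assume ij: "i \<in> I" "j \<in> I" "i \<noteq> j"
      and "poly (pderiv (g i)) t / poly (g i) t = poly (pderiv (g j)) t / poly (g j) t"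
    then have "poly (W i j) t = 0"
      using nonroot by (simp add: W_def field_simps)
    with t ij show False by (auto simp: B_def)
  qed
  with nonroot show ?thesis by blast
qed

section \<open>The bound on the ticket\<close>

lemma line_poly_dependence:
  assumes "(\<Sum>i\<in>I. scale (c i) (f i ^ m)) = 0"
  shows "(\<Sum>i\<in>I. smult (c i) (line_poly p q (f i) ^ m)) = 0"
proof -
  have "poly (\<Sum>i\<in>I. smult (c i) (line_poly p q (f i) ^ m)) t = 0" for t
  proof -
    have "poly (\<Sum>i\<in>I. smult (c i) (line_poly p q (f i) ^ m)) t
        = mpoly_eval (\<lambda>i. p i + t * (q i - p i)) (\<Sum>i\<in>I. scale (c i) (f i ^ m))"
      by (simp add: poly_sum poly_line_poly mpoly_eval_sum mpoly_eval_scale mpoly_eval_power)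
    then show ?thesis by (simp add: assms)
  qed
  then show ?thesis using poly_all_0_iff_0 by blast
qed

theorem theorem1:
  fixes r n d :: nat and f :: "nat \<Rightarrow> cmpoly"
  assumes "r \<ge> 2" and "n \<ge> 1" and "d \<ge> 1"
    and "\<And>j. j \<in> {1..r} \<Longrightarrow> f j \<in> polys_in {1..n}"
    and "\<And>i j. i \<in> {1..r} \<Longrightarrow> j \<in> {1..r} \<Longrightarrow> i \<noteq> j \<Longrightarrow> \<not> proportional (f i) (f j)"
    and "\<And>j. j \<in> {1..r} \<Longrightarrow> total_degree (f j) \<le> d"
  shows "finite (ticket {1..r} f) \<and> card (ticket {1..r} f) \<le> (r - 1) choose 2 \<and>
    (int d \<le> int r - 3 \<longrightarrow> card (ticket {1..r} f) < (r - 1) choose 2)"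
proof -
  obtain p q where pq: "\<forall>i\<in>{1..r}. \<forall>j\<in>{1..r}. i \<noteq> j \<longrightarrow>
    mpoly_eval p (f i) * mpoly_eval q (f j) - mpoly_eval q (f i) * mpoly_eval p (f j) \<noteq> 0"
    using line_separates[of "{1..r}" f] assms(5) by auto
  define g where "g = (\<lambda>j. line_poly p q (f (Suc j)))"
  have det: "poly (g i) 0 * poly (g j) 1 - poly (g i) 1 * poly (g j) 0 \<noteq> 0"
    if "i < r" "j < r" "i \<noteq> j" for i j
    using that pq by (simp add: g_def poly_line_poly)
  have indep: "g i \<noteq> smult c (g j)" if "i < r" "j < r" "i \<noteq> j" for i j c
    using det[OF that] by auto
  \<comment> \<open>Since \<open>r \<ge> 2\<close>, each restriction has a partner, and their nonzero determinant excludes \<open>0\<close>.\<close>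
  have nz: "g i \<noteq> 0" if "i < r" for i
  proof -
    obtain j where "j < r" "j \<noteq> i"
      using assms(1) by (metis One_nat_def less_2_cases_iff order_less_le_trans zero_neq_one)
    with det[of i j] that show ?thesis by auto
  qed
  obtain t where t: "\<forall>i\<in>{..<r}. poly (g i) t \<noteq> 0"
    and slopes: "inj_on (\<lambda>i. poly (pderiv (g i)) t / poly (g i) t) {..<r}"
    using nonroot_with_distinct_slopes[of "{..<r}" g] nz indep by auto
  have deg: "degree (g j) \<le> d" if "j < r" for j
    using order.trans[OF degree_line_poly assms(6)] that by (simp add: g_def)
  define D where "D = {m. m \<ge> 1 \<and> (\<exists>c. (\<exists>j<r. c j \<noteq> 0) \<and> (\<Sum>j<r. smult (c j) (g j ^ m)) = 0)}"
  have D: "finite D" "card D \<le> (r - 1) choose 2" "d + 3 \<le> r \<Longrightarrow> card D < (r - 1) choose 2"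
    unfolding D_def using card_dependent_exponents[OF _ slopes deg assms(3)] t by auto
  have "ticket {1..r} f \<subseteq> D"
  proof
    fix m assume "m \<in> ticket {1..r} f"
    then obtain c where m: "m \<ge> 1" and c: "\<exists>i\<in>{1..r}. c i \<noteq> 0"
      and dep: "(\<Sum>i\<in>{1..r}. scale (c i) (f i ^ m)) = 0"
      by (auto simp: ticket_def family_dependent_def)
    have "(\<Sum>j<r. smult (c (Suc j)) (g j ^ m)) = 0"
      using line_poly_dependence[OF dep, of p q] by (simp add: g_def sum.atLeast1_atMost_eq)
    moreover have "\<exists>j<r. c (Suc j) \<noteq> 0"
    proof -
      obtain i where "i \<in> {1..r}" "c i \<noteq> 0" using c by blast
      then show ?thesis by (intro exI[of _ "i - 1"]) auto
    qed
    ultimately show "m \<in> D"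
      unfolding D_def using m by (auto intro!: exI[of _ "\<lambda>j. c (Suc j)"])
  qed
  then have "finite (ticket {1..r} f)" "card (ticket {1..r} f) \<le> card D"
    using D(1) finite_subset card_mono by auto
  then show ?thesis using D by fastforce
qed

end
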